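(* Let $A=(a_{ij})$ be a non-negative real $n\times n$ matrix such that $Ae>0$, where $e$ is the vector of all ones (that is, all row sums of $A$ are strictly positive), $$a_{ii} \geq a_{i,i+1} \geq \dots \geq a_{in} \geq a_{i1} \geq \dots \geq a_{i,i-1}, \qquad i=1,\dots,n,$$ and there is an index $k\in\{1,\dots,n\}$ such that $a_{rr}>a_{rk}$ for all $r\in\{1,\dots,n\}$ with $r\neq k$. Then $A$ is a $P$-matrix.
   Context: Vector and matrix inequalities are component-wise. A real square matrix is a $P$-matrix if all its principal minors are strictly positive. *)

theory Defs
  imports "Jordan_Normal_Form.DL_Submatrix" "Jordan_Normal_Form.Determinant"
begin

definition ones_vec :: "nat \<Rightarrow> real vec" where
  "ones_vec n = vec n (\<lambda>_. 1)"

(* Rows and columns are numbered from 0; submatrix A S S keeps the rows and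
   columns whose index lies in S, in increasing order. *)
definition P_matrix :: "real mat \<Rightarrow> bool" where
  "P_matrix A \<longleftrightarrow> square_mat A \<and>
     (\<forall>S. S \<subseteq> {..<dim_row A} \<and> S \<noteq> {} \<longrightarrow> 0 < det (submatrix A S S))"

(* The list [i..<n] @ [0..<i] runs once through the column indices i, i+1, ..., n-1, 0, ..., i-1;
   there is no comparison from the last entry (i-1) back to the first (i). *)
definition cyclically_decreasing_rows :: "nat \<Rightarrow> real mat \<Rightarrow> bool" where
  "cyclically_decreasing_rows n A \<longleftrightarrow>
     (\<forall>i<n. sorted_wrt (\<ge>) (map (\<lambda>j. A $$ (i, j)) ([i..<n] @ [0..<i])))"

end

theory Submission
  imports Defs
begin

text \<open>
  The hypotheses pass to principal submatrices and to the segment from the identity to \<open>A\<close>,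
  so by continuity of the determinant it suffices to show that \<open>A x = 0\<close> forces \<open>x = 0\<close>.
  Let \<open>S m\<close> be the sum of \<open>m\<close> consecutive entries of \<open>x\<close>, starting at position \<open>k\<close> and
  continuing cyclically, and assume \<open>0 \<le> S n\<close>, replacing \<open>x\<close> by \<open>-x\<close> if necessary.
  Summation by parts in row \<open>k + p\<close> expresses \<open>S p\<close> as a weighted mean of
  \<open>S (p + 1), \<dots>, S (p + n)\<close>, where for \<open>0 < p\<close> some weight among the first \<open>n - p\<close> is
  positive because the entry in column \<open>k\<close> is smaller than the diagonal one. Hence the last
  minimum of \<open>S\<close> on \<open>{1..n}\<close> is at \<open>n\<close>, and row \<open>k\<close> then gives \<open>S n = 0\<close> and \<open>0 \<le> S\<close>.
  The same applies to \<open>-x\<close>, so \<open>S = 0\<close>.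
\<close>

section \<open>Summation by parts with decreasing weights\<close>

lemma sum_by_parts:
  fixes b y :: "nat \<Rightarrow> real"
  shows "(\<Sum>i<N. b i * y i) = b N * sum y {..<N} + (\<Sum>i<N. (b i - b (Suc i)) * sum y {..<Suc i})"
  by (induction N) (auto simp: algebra_simps)

text \<open>After summation by parts the coefficients \<open>b i - b (Suc i)\<close> are
  nonnegative, and \<open>b N = 0\<close> kills the boundary term. Since \<open>b q < b 0\<close>, a
  strict drop occurs before position \<open>q\<close>, where the partial sum is positive.\<close>

lemma sum_antimono_weights_pos:
  fixes b y :: "nat \<Rightarrow> real"
  assumes anti: "\<And>i. i < N \<Longrightarrow> b (Suc i) \<le> b i"
    and b_N: "b N = 0"
    and nonneg: "\<And>i. i \<le> N \<Longrightarrow> 0 \<le> sum y {..<i}"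
    and pos: "\<And>i. 1 \<le> i \<Longrightarrow> i \<le> q \<Longrightarrow> 0 < sum y {..<i}"
    and q: "q \<le> N" "b q < b 0"
  shows "0 < (\<Sum>i<N. b i * y i)"
proof -
  have "\<exists>i<q. b (Suc i) < b i"
  proof (rule ccontr)
    assume "\<not> (\<exists>i<q. b (Suc i) < b i)"
    then have step: "b i \<le> b (Suc i)" if "i < q" for i
      using that not_less by blast
    have "i \<le> q \<Longrightarrow> b 0 \<le> b i" for i
    proof (induction i)
      case (Suc i)
      then show ?case using step[of i] by simp
    qed simp
    from this[of q] show False using q by simp
  qed
  then obtain i where i: "i < q" "b (Suc i) < b i" by blast
  have "0 < (\<Sum>i<N. (b i - b (Suc i)) * sum y {..<Suc i})"
  proof (rule sum_pos2[of _ i])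
    show "0 < (b i - b (Suc i)) * sum y {..<Suc i}"
      using i pos[of "Suc i"] by (intro mult_pos_pos) auto
    show "0 \<le> (b j - b (Suc j)) * sum y {..<Suc j}" if "j \<in> {..<N}" for j
      using that anti[of j] nonneg[of "Suc j"] by (intro mult_nonneg_nonneg) auto
  qed (use i q in auto)
  then show ?thesis using sum_by_parts[of b y N] b_N by (simp del: sum.lessThan_Suc)
qed

section \<open>Cyclic order and rotations of the index set\<close>

text \<open>\<open>j\<close> does not come after \<open>l\<close> in the enumeration \<open>i, i + 1, \<dots>, n - 1, 0, \<dots>, i - 1\<close>.\<close>
definition cyc_le :: "nat \<Rightarrow> nat \<Rightarrow> nat \<Rightarrow> bool" where
  "cyc_le i j l \<longleftrightarrow> i \<le> j \<and> j \<le> l \<or> j \<le> l \<and> l < i \<or> l < i \<and> i \<le> j"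

text \<open>Positive row sums are encoded as positive diagonal entries: this is equivalent, since
  each diagonal entry is the largest of its nonnegative row, and principal submatrices visibly
  inherit it.\<close>

definition cyc_dominant :: "nat \<Rightarrow> nat \<Rightarrow> (nat \<Rightarrow> nat \<Rightarrow> real) \<Rightarrow> bool" where
  "cyc_dominant n k a \<longleftrightarrow> k < n \<and>
     (\<forall>i<n. \<forall>j<n. 0 \<le> a i j) \<and>
     (\<forall>i<n. 0 < a i i) \<and>
     (\<forall>i<n. \<forall>j<n. \<forall>l<n. cyc_le i j l \<longrightarrow> a i l \<le> a i j) \<and>
     (\<forall>i<n. i \<noteq> k \<longrightarrow> a i k < a i i)"

lemma add_mod_if_less:
  fixes i r n :: nat
  assumes "r < n" "i < n"
  shows "(r + i) mod n = (if r + i < n then r + i else r + i - n)"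
  using assms by (cases "r + i < n") (simp_all add: le_mod_geq)

lemma cyc_le_rotate:
  assumes "r < n" "i \<le> j" "j < n"
  shows "cyc_le r ((r + i) mod n) ((r + j) mod n)"
  using assms add_mod_if_less[of r n i] add_mod_if_less[of r n j]
  by (auto simp: cyc_le_def)

lemma bij_betw_rotate:
  fixes n r :: nat
  assumes "r < n"
  shows "bij_betw (\<lambda>i. (r + i) mod n) {..<n} {..<n}"
proof -
  have "inj_on (\<lambda>i. (r + i) mod n) {..<n}"
  proof (rule inj_onI)
    fix i j assume "i \<in> {..<n}" "j \<in> {..<n}" "(r + i) mod n = (r + j) mod n"
    then show "i = j"
      using assms add_mod_if_less[of r n i] add_mod_if_less[of r n j]
      by (auto split: if_splits)
  qed
  moreover have "(\<lambda>i. (r + i) mod n) ` {..<n} \<subseteq> {..<n}"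
    using assms by (intro image_subsetI) simp
  ultimately show ?thesis
    unfolding bij_betw_def using endo_inj_surj[OF finite_lessThan] by blast
qed

section \<open>Cyclic partial sums of a kernel vector\<close>

definition rotated_psum :: "nat \<Rightarrow> nat \<Rightarrow> (nat \<Rightarrow> real) \<Rightarrow> nat \<Rightarrow> real" where
  "rotated_psum n k x m = (\<Sum>j<m. x ((k + j) mod n))"

context
  fixes n k :: nat and a :: "nat \<Rightarrow> nat \<Rightarrow> real" and x :: "nat \<Rightarrow> real"
  assumes dom: "cyc_dominant n k a"
    and ker: "\<And>r. r < n \<Longrightarrow> (\<Sum>j<n. a r j * x j) = 0"
begin

private abbreviation "psum \<equiv> rotated_psum n k x"

lemma psum_periodic: "psum (n + i) = psum n + psum i"
proof (induction i)
  case (Suc i)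
  have "(k + (n + i)) mod n = (k + i) mod n"
    by (simp only: add.left_commute[of k n] mod_add_self1)
  with Suc show ?case by (simp add: rotated_psum_def)
qed (simp add: rotated_psum_def)

text \<open>Lengths may exceed \<open>n\<close>, so the single sequence \<open>psum\<close> covers
  the windows starting at any row index.\<close>

lemma psum_shift: "(\<Sum>i<m. x ((k + p + i) mod n)) = psum (p + m) - psum p"
  by (induction m) (auto simp: rotated_psum_def add.assoc)

text \<open>If \<open>psum p\<close> lay below the sums that follow it, row
  \<open>(k + p) mod n\<close>, read from its diagonal on, would have a positive value on
  \<open>x\<close> instead of zero.\<close>

lemma psum_not_dominated:
  assumes p: "p < n" and q: "q = n \<or> q = n - p \<and> 0 < p"
    and nonneg: "\<And>i. i \<le> n \<Longrightarrow> psum p \<le> psum (p + i)"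
    and pos: "\<And>i. 1 \<le> i \<Longrightarrow> i \<le> q \<Longrightarrow> psum p < psum (p + i)"
  shows False
proof -
  define r where "r = (k + p) mod n"
  define b where "b i = (if i < n then a r ((r + i) mod n) else 0)" for i
  define y where "y i = x ((r + i) mod n)" for i
  have k: "k < n" using dom by (simp add: cyc_dominant_def)
  then have r: "r < n" by (simp add: r_def)
  have psum_y: "sum y {..<i} = psum (p + i) - psum p" for i
    unfolding y_def psum_shift[symmetric] r_def by (simp add: mod_simps)
  \<comment> \<open>For \<open>q = n\<close> the drop is from the positive diagonal entry to the
    default value 0. For \<open>q = n - p\<close>, position \<open>q\<close> is column
    \<open>k\<close>, and the row is not \<open>k\<close> because \<open>0 < p < n\<close>.\<close>
  have b_q: "b q < b 0"
  proof (cases "q = n")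
    case True
    then show ?thesis using dom r by (simp add: b_def cyc_dominant_def)
  next
    case False
    with q have *: "q = n - p" "0 < p" by auto
    have "(r + q) mod n = (k + p + q) mod n" by (simp add: r_def mod_simps)
    also have "\<dots> = k" using * p k by simp
    finally have "(r + q) mod n = k" .
    moreover have "r \<noteq> k" using * p k by (auto simp: r_def add_mod_if_less)
    ultimately show ?thesis using dom r * p(1)
      by (simp add: b_def cyc_dominant_def)
  qed
  have "0 < (\<Sum>i<n. b i * y i)"
  proof (rule sum_antimono_weights_pos)
    show "b (Suc i) \<le> b i" if "i < n" for i
    proof (cases "Suc i < n")
      case True
      then have "cyc_le r ((r + i) mod n) ((r + Suc i) mod n)"
        using r by (intro cyc_le_rotate) auto
      then show ?thesis using dom r True by (simp add: b_def cyc_dominant_def)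
    next
      case False
      then show ?thesis using dom r that by (simp add: b_def cyc_dominant_def)
    qed
    show "q \<le> n" using q by auto
  qed (use nonneg pos b_q in \<open>auto simp: psum_y b_def\<close>)
  also have "(\<Sum>i<n. b i * y i) = (\<Sum>i<n. a r ((r + i) mod n) * x ((r + i) mod n))"
    by (simp add: b_def y_def)
  also have "\<dots> = (\<Sum>j<n. a r j * x j)"
    by (rule sum.reindex_bij_betw[OF bij_betw_rotate[OF r]])
  finally show False using ker r by simp
qed

lemma psum_nonneg:
  assumes T: "0 \<le> psum n" and i: "i \<le> n"
  shows "psum n = 0 \<and> 0 \<le> psum i"
proof -
  have n: "0 < n" using dom by (auto simp: cyc_dominant_def)
  \<comment> \<open>The largest minimizer is used, so that all later values up to \<open>n\<close>
    are strictly larger.\<close>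
  define M where "M = {i \<in> {1..n}. \<forall>j\<in>{1..n}. psum i \<le> psum j}"
  have "finite {1..n}" "{1..n} \<noteq> {}" using n by auto
  then have "arg_min_on psum {1..n} \<in> M"
    unfolding M_def by (blast intro: arg_min_if_finite(1) arg_min_least)
  then have "M \<noteq> {}" by blast
  moreover have "finite M" by (simp add: M_def)
  ultimately have Max: "Max M \<in> M" "\<And>i. i \<in> M \<Longrightarrow> i \<le> Max M" by auto
  define p where "p = Max M"
  have p: "p \<in> {1..n}" "\<And>j. j \<in> {1..n} \<Longrightarrow> psum p \<le> psum j"
    using Max(1) by (auto simp: M_def p_def)
  have strict: "psum p < psum j" if "p < j" "j \<le> n" for j
  proof (rule ccontr)
    assume "\<not> psum p < psum j"
    then have le: "psum j \<le> psum p" by simp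
    have "psum j \<le> psum i" if "i \<in> {1..n}" for i
      using le p(2)[OF that] by (rule order_trans)
    then have "j \<in> M" using that p(1) by (simp add: M_def)
    then show False using Max(2)[of j] \<open>p < j\<close> by (simp add: p_def)
  qed
  have "p = n"
  proof (rule ccontr)
    assume "p \<noteq> n"
    then have pn: "p < n" using p by simp
    show False
    proof (rule psum_not_dominated[of p "n - p"])
      fix i assume "i \<le> n"
      show "psum p \<le> psum (p + i)"
      proof (cases "p + i \<le> n")
        case True
        then show ?thesis using p by auto
      next
        case False
        \<comment> \<open>Beyond \<open>n\<close> the values repeat, shifted by
          \<open>psum n\<close>, which \<open>T\<close> makes nonnegative.\<close>
        then have "psum (p + i) = psum n + psum (p + i - n)"
          using psum_periodic[of "p + i - n"] by simp
        moreover have "psum p \<le> psum (p + i - n)"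
          using False \<open>i \<le> n\<close> pn by (intro p) auto
        ultimately show ?thesis using T by simp
      qed
    qed (use p pn strict in auto)
  qed
  have "psum n = 0"
  proof (rule ccontr)
    assume "psum n \<noteq> 0"
    then have *: "0 < psum i" if "i \<in> {1..n}" for i
      using p(2)[OF that] T \<open>p = n\<close> by simp
    have "psum 0 = 0" by (simp add: rotated_psum_def)
    show False
    \<comment> \<open>In row \<open>k\<close>, column \<open>k\<close> is the diagonal and gives no
      strict drop; the drop to 0 after the last entry is used, which needs positivity up to
      \<open>n\<close>.\<close>
    proof (rule psum_not_dominated[of 0 n])
      show "psum 0 < psum (0 + i)" if "1 \<le> i" "i \<le> n" for i
        using *[of i] \<open>psum 0 = 0\<close> that by simp
      then show "psum 0 \<le> psum (0 + i)" if "i \<le> n" for i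
        using that by (cases "i = 0") (auto intro: less_imp_le)
    qed (use n in simp_all)
  qed
  moreover have "0 \<le> psum i"
    using p(2)[of i] i \<open>p = n\<close> calculation by (cases "i = 0") (auto simp: rotated_psum_def)
  ultimately show ?thesis by simp
qed

end

lemma cyc_dominant_kernel_trivial:
  assumes dom: "cyc_dominant n k a"
    and ker: "\<And>r. r < n \<Longrightarrow> (\<Sum>j<n. a r j * x j) = 0"
    and "j < n"
  shows "x j = 0"
proof -
  let ?y = "\<lambda>j. - x j"
  have kn: "k < n" using dom by (simp add: cyc_dominant_def)
  have ker': "(\<Sum>j<n. a r j * ?y j) = 0" if "r < n" for r
    using ker[OF that] by (simp add: sum_negf)
  have neg: "rotated_psum n k ?y m = - rotated_psum n k x m" for m
    by (simp add: rotated_psum_def sum_negf)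
  \<comment> \<open>One of \<open>x\<close> and \<open>-x\<close> has nonnegative total, which is
    then zero; afterwards \<open>psum_nonneg\<close> applies to both signs.\<close>
  have T: "rotated_psum n k x n = 0"
    using psum_nonneg[OF dom ker, of n] psum_nonneg[OF dom ker', of n] neg[of n] by force
  have zero: "rotated_psum n k x i = 0" if "i \<le> n" for i
    using psum_nonneg[OF dom ker _ that] psum_nonneg[OF dom ker' _ that] neg[of n] neg[of i] T
    by simp
  have "j \<in> (\<lambda>i. (k + i) mod n) ` {..<n}"
    unfolding bij_betw_imp_surj_on[OF bij_betw_rotate[OF kn]] using \<open>j < n\<close> by simp
  then obtain i where i: "i < n" "(k + i) mod n = j" by auto
  have "x ((k + i) mod n) = rotated_psum n k x (Suc i) - rotated_psum n k x i"
    by (simp add: rotated_psum_def)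
  also have "\<dots> = 0" using zero i by simp
  finally show ?thesis using i by simp
qed

section \<open>Sign of the determinant\<close>

lemma cyc_dominant_det_nonzero:
  assumes dom: "cyc_dominant n k a"
  shows "det (mat n n (\<lambda>(i, j). a i j)) \<noteq> 0"
proof
  let ?A = "mat n n (\<lambda>(i, j). a i j)"
  assume "det ?A = 0"
  then obtain v where v: "v \<in> carrier_vec n" "v \<noteq> 0\<^sub>v n" "?A *\<^sub>v v = 0\<^sub>v n"
    using det_0_iff_vec_prod_zero[of ?A n] by auto
  have "(\<Sum>j<n. a r j * v $ j) = 0" if "r < n" for r
  proof -
    have "(?A *\<^sub>v v) $ r = 0" using v that by simp
    then show ?thesis
      using v(1) that by (simp add: scalar_prod_def lessThan_atLeast0)
  qed
  then have "v $ j = 0" if "j < n" for j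
    using cyc_dominant_kernel_trivial[OF dom] that by blast
  with v show False by (auto intro: eq_vecI)
qed

lemma cyc_dominant_convex_id:
  assumes dom: "cyc_dominant n k a" and t: "0 \<le> t" "t \<le> 1"
  shows "cyc_dominant n k (\<lambda>i j. (1 - t) * of_bool (i = j) + t * a i j)"
proof -
  let ?b = "\<lambda>i j. (1 - t) * of_bool (i = j) + t * a i j"
  have k: "k < n" using dom by (simp add: cyc_dominant_def)
  have nonneg: "0 \<le> a i j" if "i < n" "j < n" for i j
    using dom that by (simp add: cyc_dominant_def)
  have anti: "a i l \<le> a i j" if "i < n" "j < n" "l < n" "cyc_le i j l" for i j l
    using dom that by (simp add: cyc_dominant_def)
  have pos: "0 < (1 - t) + t * c" if "0 < c" for c
    using t that by (cases "t = 0") (simp_all add: add_nonneg_pos)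
  have "0 < ?b i i" if "i < n" for i
    using pos[of "a i i"] dom that by (simp add: cyc_dominant_def)
  moreover have "0 \<le> ?b i j" if "i < n" "j < n" for i j
    using t nonneg[OF that] by simp
  moreover have "?b i l \<le> ?b i j" if "i < n" "j < n" "l < n" "cyc_le i j l" for i j l
  proof -
    \<comment> \<open>The identity respects the cyclic order because the diagonal position comes
      first in its row.\<close>
    have "i = l \<Longrightarrow> i = j" using that by (auto simp: cyc_le_def)
    moreover have "t * a i l \<le> t * a i j" using anti[OF that] t by (simp add: mult_left_mono)
    ultimately show ?thesis using t by auto
  qed
  moreover have "?b i k < ?b i i" if "i < n" "i \<noteq> k" for i
  proof -
    have "a i k < a i i" using dom that by (simp add: cyc_dominant_def)
    then show ?thesis using pos[of "a i i - a i k"] that by (simp add: right_diff_distrib)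
  qed
  ultimately show ?thesis using k by (simp add: cyc_dominant_def)
qed

lemma cyc_dominant_det_pos:
  assumes dom: "cyc_dominant n k a"
  shows "0 < det (mat n n (\<lambda>(i, j). a i j))"
proof (rule ccontr)
  define B where "B t = mat n n (\<lambda>(i, j). (1 - t) * of_bool (i = j) + t * a i j)" for t :: real
  assume *: "\<not> 0 < det (mat n n (\<lambda>(i, j). a i j))"
  have B1: "B 1 = mat n n (\<lambda>(i, j). a i j)" by (auto simp: B_def)
  have B0: "B 0 = 1\<^sub>m n" by (auto simp: B_def)
  \<comment> \<open>The Leibniz formula exhibits the determinant as a polynomial in
    \<open>t\<close>, hence continuous.\<close>
  have "det (B t) = (\<Sum>p | p permutes {0..<n}. signof p *
      (\<Prod>i = 0..<n. (1 - t) * of_bool (i = p i) + t * a i (p i)))" for t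
    unfolding B_def by (auto simp: det_def intro!: sum.cong prod.cong)
  then have "continuous_on {0..1} (\<lambda>t. det (B t))"
    by (auto intro!: continuous_intros)
  then have "\<exists>t\<ge>0. t \<le> 1 \<and> det (B t) = 0"
    using * B1 B0 by (intro IVT2') auto
  then show False
    using cyc_dominant_det_nonzero[OF cyc_dominant_convex_id[OF dom]] by (auto simp: B_def)
qed

section \<open>Principal submatrices\<close>

lemma cyc_dominant_submatrix:
  assumes dom: "cyc_dominant n k a"
    and mono: "strict_mono_on {..<m} f" and f: "f ` {..<m} \<subseteq> {..<n}" and "0 < m"
  shows "\<exists>l. cyc_dominant m l (\<lambda>i j. a (f i) (f j))"
proof -
  have fn: "f i < n" if "i < m" for i using f that by auto
  have less: "f i < f j \<longleftrightarrow> i < j" and le: "f i \<le> f j \<longleftrightarrow> i \<le> j" if "i < m" "j < m" for i j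
    using strict_mono_on_less[OF mono] strict_mono_on_less_eq[OF mono] that by auto
  \<comment> \<open>\<open>cyc_le\<close> depends only on relative order, which \<open>f\<close>
    preserves. Only the distinguished column must be chosen anew, as \<open>k\<close> need not be
    selected.\<close>
  have cyc: "cyc_le (f i) (f j) (f l) \<longleftrightarrow> cyc_le i j l" if "i < m" "j < m" "l < m" for i j l
    using that less le by (simp add: cyc_le_def)
  \<comment> \<open>The role of \<open>k\<close> is taken by the first selected index that follows it cyclically.\<close>
  define l where "l = (if \<exists>i<m. k \<le> f i then LEAST i. i < m \<and> k \<le> f i else 0)"
  have l: "l < m" and between: "\<And>i. i < m \<Longrightarrow> i \<noteq> l \<Longrightarrow> cyc_le (f i) k (f l)"
  proof -
    have "l < m \<and> (\<forall>i<m. i \<noteq> l \<longrightarrow> cyc_le (f i) k (f l))"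
    proof (cases "\<exists>i<m. k \<le> f i")
      case True
      then have "l < m \<and> k \<le> f l"
        unfolding l_def by (smt (verit, best) LeastI_ex)
      moreover have "f i < k" if "i < l" for i
        using not_less_Least[of i "\<lambda>i. i < m \<and> k \<le> f i"] that True calculation
        by (auto simp: l_def)
      moreover have "f l < f i" if "l < i" "i < m" for i
        using that less calculation by auto
      ultimately show ?thesis
        by (force simp: cyc_le_def neq_iff)
    next
      case False
      \<comment> \<open>All selected indices lie below \<open>k\<close>, so the search wraps around
        to position 0.\<close>
      then show ?thesis
        using \<open>0 < m\<close> less by (auto simp: l_def cyc_le_def not_le)
    qed
    then show "l < m" "\<And>i. i < m \<Longrightarrow> i \<noteq> l \<Longrightarrow> cyc_le (f i) k (f l)" by auto
  qed
  have "a (f i) (f l) < a (f i) (f i)" if "i < m" "i \<noteq> l" for i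
  proof (cases "f i = k")
    case True
    \<comment> \<open>The strict inequality is unavailable in row \<open>k\<close>, but then \<open>l\<close> selects \<open>k\<close> itself.\<close>
    have "\<exists>i<m. k \<le> f i" using True that by auto
    then have "k \<le> f l" "l \<le> i"
      unfolding l_def using True that
      by (auto intro: LeastI2 Least_le)
    then show ?thesis using True that less[of l i] l by simp
  next
    case False
    then have "a (f i) k < a (f i) (f i)"
      using dom fn that by (simp add: cyc_dominant_def)
    moreover have "a (f i) (f l) \<le> a (f i) k"
      using dom fn that l between[OF that] by (simp add: cyc_dominant_def)
    ultimately show ?thesis by simp
  qed
  then have "cyc_dominant m l (\<lambda>i j. a (f i) (f j))"
    using dom fn l cyc unfolding cyc_dominant_def by simp
  then show ?thesis by blast
qed

section \<open>From the matrix hypotheses to cyclic dominance\<close>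

lemma cyclically_decreasing_rowsD:
  assumes dec: "cyclically_decreasing_rows n A" and "i < n" "j < n" "l < n" "cyc_le i j l"
  shows "A $$ (i, l) \<le> A $$ (i, j)"
proof -
  have "sorted_wrt (\<lambda>j l. A $$ (i, l) \<le> A $$ (i, j)) ([i..<n] @ [0..<i])"
    using dec \<open>i < n\<close> by (simp add: cyclically_decreasing_rows_def sorted_wrt_map del: map_append)
  then have up: "sorted_wrt (\<lambda>j l. A $$ (i, l) \<le> A $$ (i, j)) [i..<n]"
    and low: "sorted_wrt (\<lambda>j l. A $$ (i, l) \<le> A $$ (i, j)) [0..<i]"
    and mixed: "\<forall>j\<in>{i..<n}. \<forall>l\<in>{0..<i}. A $$ (i, l) \<le> A $$ (i, j)"
    by (auto simp: sorted_wrt_append)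
  \<comment> \<open>Equality is split off because \<open>sorted_wrt\<close> compares only distinct
    positions.\<close>
  consider "j = l" | "i \<le> j" "j < l" | "j < l" "l < i" | "l < i" "i \<le> j"
    using \<open>cyc_le i j l\<close> by (fastforce simp: cyc_le_def)
  then show ?thesis
  proof cases
    case 2
    then show ?thesis
      using sorted_wrt_nth_less[OF up, of "j - i" "l - i"] \<open>l < n\<close> by simp
  next
    case 3
    then show ?thesis
      using sorted_wrt_nth_less[OF low, of j l] by simp
  qed (use mixed \<open>j < n\<close> in auto)
qed

theorem theorem10:
  fixes A :: "real mat" and n :: nat
  assumes "A \<in> carrier_mat n n"
    and "\<forall>i<n. \<forall>j<n. 0 \<le> A $$ (i, j)"
    and "\<forall>i<n. 0 < (A *\<^sub>v ones_vec n) $ i"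
    and "cyclically_decreasing_rows n A"
    and "\<exists>k<n. \<forall>r<n. r \<noteq> k \<longrightarrow> A $$ (r, k) < A $$ (r, r)"
  shows "P_matrix A"
proof -
  have diag: "0 < A $$ (i, i)" if i: "i < n" for i
  proof (rule ccontr)
    assume "\<not> 0 < A $$ (i, i)"
    moreover have "A $$ (i, j) \<le> A $$ (i, i)" if "j < n" for j
      using i that by (intro cyclically_decreasing_rowsD[OF assms(4)]) (auto simp: cyc_le_def)
    ultimately have "(\<Sum>j<n. A $$ (i, j)) \<le> 0"
      by (intro sum_nonpos) force
    moreover have "(A *\<^sub>v ones_vec n) $ i = (\<Sum>j<n. A $$ (i, j))"
      using assms(1) i by (auto simp: ones_vec_def scalar_prod_def lessThan_atLeast0)
    ultimately show False using assms(3) i by force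
  qed
  obtain k where "k < n" "\<forall>r<n. r \<noteq> k \<longrightarrow> A $$ (r, k) < A $$ (r, r)"
    using assms(5) by blast
  then have dom: "cyc_dominant n k (\<lambda>i j. A $$ (i, j))"
    using assms(2) diag cyclically_decreasing_rowsD[OF assms(4)]
    by (auto simp: cyc_dominant_def)
  have dims: "dim_row A = n" "dim_col A = n" using assms(1) by auto
  have "0 < det (submatrix A S S)" if S: "S \<subseteq> {..<n}" "S \<noteq> {}" for S
  proof -
    have fin: "finite S" using S finite_subset by blast
    have S_eq: "{i. i < n \<and> i \<in> S} = S" using S by auto
    have sub: "submatrix A S S = mat (card S) (card S) (\<lambda>(i, j). A $$ (pick S i, pick S j))"
      unfolding submatrix_def dims S_eq ..
    \<comment> \<open>\<open>pick S\<close> enumerates \<open>S\<close> increasingly and serves as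
      the selection \<open>f\<close>.\<close>
    have "strict_mono_on {..<card S} (pick S)"
      by (auto intro!: strict_mono_onI pick_mono)
    moreover have "pick S ` {..<card S} \<subseteq> {..<n}"
      using S pick_in_set by blast
    moreover have "0 < card S" using fin S by (simp add: card_gt_0_iff)
    ultimately obtain l where
      "cyc_dominant (card S) l (\<lambda>i j. A $$ (pick S i, pick S j))"
      using cyc_dominant_submatrix[OF dom] by blast
    then show ?thesis unfolding sub by (rule cyc_dominant_det_pos)
  qed
  then show ?thesis using dims by (simp add: P_matrix_def)
qed

end
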